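(* The interpretability logic $\mathbf{IL M_0}$ is modally complete: for every formula $\varphi$, if $\varphi$ is forced at every world of every $\mathbf{IL}$-model whose underlying frame satisfies $\forall w,x,y,y',z\,(wRxRyS_wy'Rz\rightarrow xRz)$, then $\mathbf{IL M_0}\vdash\varphi$.
   Context: Formulas are built from propositional variables and $\bot$ by $\rightarrow$, $\Box$ and the binary modality $\rhd$; $\Diamond A:=\neg\Box\neg A$. The logic $\mathbf{IL}$ is the smallest set of formulas containing all tautologies and all instances of: L1 $\Box(A\rightarrow B)\rightarrow(\Box A\rightarrow\Box B)$; L2 $\Box A\rightarrow\Box\Box A$; L3 $\Box(\Box A\rightarrow A)\rightarrow\Box A$; J1 $\Box(A\rightarrow B)\rightarrow A\rhd B$; J2 $(A\rhd B)\wedge(B\rhd C)\rightarrow A\rhd C$; J3 $(A\rhd C)\wedge(B\rhd C)\rightarrow A\vee B\rhd C$; J4 $A\rhd B\rightarrow(\Diamond A\rightarrow\Diamond B)$; J5 $\Diamond A\rhd A$; and closed under modus ponens and necessitation ($A/\Box A$). $\mathbf{IL M_0}$ is $\mathbf{IL}$ plus all instances of $\mathsf{M_0}$: $A\rhd B\rightarrow \Diamond A\wedge\Box C\rhd B\wedge\Box C$. An $\mathbf{IL}$-frame is $\langle W,R,S\rangle$ with $W$ non-empty countable, $R$ a binary relation on $W$, $S=\{S_x\}_{x\in W}$ binary relations, such that: $R$ is conversely well-founded; $R$ is transitive; $yS_xz\rightarrow xRy\wedge xRz$; $xRy\rightarrow yS_xy$; $xRyRz\rightarrow yS_xz$; each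 $S_x$ is transitive. An $\mathbf{IL}$-model adds a valuation; forcing is classical for Boolean connectives, $w\Vdash\Box A$ iff $A$ holds at all $R$-successors of $w$, and $w\Vdash A\rhd B$ iff for every $u$ with $wRu$ and $u\Vdash A$ there is $v$ with $uS_wv$ and $v\Vdash B$. Binary relations are chained, e.g. $wRxRyS_wy'Rz$ means $wRx\wedge xRy\wedge yS_wy'\wedge y'Rz$. *)

theory Defs
  imports "HOL-Library.Countable_Set"
begin

section \<open>Formulas\<close>

datatype fm =
    Var nat
  | Bot  (\<open>\<^bold>\<bottom>\<close>)
  | Imp fm fm  (infixr \<open>\<^bold>\<longrightarrow>\<close> 55)
  | Box fm  (\<open>\<^bold>\<box> _\<close> [90] 90)
  | Rhd fm fm  (infix \<open>\<rhd>\<close> 60)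

abbreviation Neg :: "fm \<Rightarrow> fm"  (\<open>\<^bold>\<not> _\<close> [90] 90)
  where "\<^bold>\<not> A \<equiv> A \<^bold>\<longrightarrow> \<^bold>\<bottom>"

abbreviation Or :: "fm \<Rightarrow> fm \<Rightarrow> fm"  (infixr \<open>\<^bold>\<or>\<close> 65)
  where "A \<^bold>\<or> B \<equiv> \<^bold>\<not> A \<^bold>\<longrightarrow> B"

abbreviation And :: "fm \<Rightarrow> fm \<Rightarrow> fm"  (infixr \<open>\<^bold>\<and>\<close> 70)
  where "A \<^bold>\<and> B \<equiv> \<^bold>\<not> (A \<^bold>\<longrightarrow> \<^bold>\<not> B)"

abbreviation Dia :: "fm \<Rightarrow> fm"  (\<open>\<^bold>\<diamond> _\<close> [90] 90)
  where "\<^bold>\<diamond> A \<equiv> \<^bold>\<not> \<^bold>\<box> \<^bold>\<not> A"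


section \<open>The logics\<close>

text \<open>Tautologies are taken in the full modal language: boxed formulas and
  \<open>\<rhd>\<close>-formulas are treated as propositional atoms, so \<open>v\<close> is consulted only on
  these and on variables.\<close>

primrec tval :: "(fm \<Rightarrow> bool) \<Rightarrow> fm \<Rightarrow> bool" where
  "tval v (Var p) = v (Var p)"
| "tval v \<^bold>\<bottom> = False"
| "tval v (A \<^bold>\<longrightarrow> B) = (tval v A \<longrightarrow> tval v B)"
| "tval v (\<^bold>\<box> A) = v (\<^bold>\<box> A)"
| "tval v (A \<rhd> B) = v (A \<rhd> B)"

definition tautology :: "fm \<Rightarrow> bool" where
  "tautology A \<longleftrightarrow> (\<forall>v. tval v A)"

text \<open>The extension of \<open>IL\<close> by the formulas in \<open>X\<close> as additional axioms.\<close>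

inductive_set IL_plus :: "fm set \<Rightarrow> fm set" for X :: "fm set" where
  Taut: "tautology A \<Longrightarrow> A \<in> IL_plus X"
| L1: "\<^bold>\<box> (A \<^bold>\<longrightarrow> B) \<^bold>\<longrightarrow> (\<^bold>\<box> A \<^bold>\<longrightarrow> \<^bold>\<box> B) \<in> IL_plus X"
| L2: "\<^bold>\<box> A \<^bold>\<longrightarrow> \<^bold>\<box> \<^bold>\<box> A \<in> IL_plus X"
| L3: "\<^bold>\<box> (\<^bold>\<box> A \<^bold>\<longrightarrow> A) \<^bold>\<longrightarrow> \<^bold>\<box> A \<in> IL_plus X"
| J1: "\<^bold>\<box> (A \<^bold>\<longrightarrow> B) \<^bold>\<longrightarrow> (A \<rhd> B) \<in> IL_plus X"
| J2: "(A \<rhd> B) \<^bold>\<and> (B \<rhd> C) \<^bold>\<longrightarrow> (A \<rhd> C) \<in> IL_plus X"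
| J3: "(A \<rhd> C) \<^bold>\<and> (B \<rhd> C) \<^bold>\<longrightarrow> ((A \<^bold>\<or> B) \<rhd> C) \<in> IL_plus X"
| J4: "(A \<rhd> B) \<^bold>\<longrightarrow> (\<^bold>\<diamond> A \<^bold>\<longrightarrow> \<^bold>\<diamond> B) \<in> IL_plus X"
| J5: "(\<^bold>\<diamond> A \<rhd> A) \<in> IL_plus X"
| Ax: "A \<in> X \<Longrightarrow> A \<in> IL_plus X"
| MP: "A \<^bold>\<longrightarrow> B \<in> IL_plus X \<Longrightarrow> A \<in> IL_plus X \<Longrightarrow> B \<in> IL_plus X"
| Nec: "A \<in> IL_plus X \<Longrightarrow> \<^bold>\<box> A \<in> IL_plus X"

definition IL :: "fm set" where
  "IL = IL_plus {}"

definition M0_axioms :: "fm set" where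
  "M0_axioms = {(A \<rhd> B) \<^bold>\<longrightarrow> ((\<^bold>\<diamond> A \<^bold>\<and> \<^bold>\<box> C) \<rhd> (B \<^bold>\<and> \<^bold>\<box> C)) | A B C. True}"

definition ILM0 :: "fm set" where
  "ILM0 = IL_plus M0_axioms"


section \<open>Frames, models and forcing\<close>

text \<open>The family \<open>S\<close> is a total function on the type, but only its members \<open>S x\<close> with
  \<open>x \<in> W\<close> belong to the frame; nothing is required of the others, and forcing at worlds
  of \<open>W\<close> does not depend on them.\<close>

locale IL_frame =
  fixes W :: "'w set" and R :: "'w rel" and S :: "'w \<Rightarrow> 'w rel"
  assumes W_nonempty: "W \<noteq> {}"
    and W_countable: "countable W"
    and R_on_W: "R \<subseteq> W \<times> W"
    and R_conv_wf: "wf (R\<inverse>)"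
    and R_trans: "trans R"
    and S_imp_R: "\<And>x y z. x \<in> W \<Longrightarrow> (y, z) \<in> S x \<Longrightarrow> (x, y) \<in> R \<and> (x, z) \<in> R"
    and S_refl: "\<And>x y. (x, y) \<in> R \<Longrightarrow> (y, y) \<in> S x"
    and R_imp_S: "\<And>x y z. (x, y) \<in> R \<Longrightarrow> (y, z) \<in> R \<Longrightarrow> (y, z) \<in> S x"
    and S_trans: "\<And>x. x \<in> W \<Longrightarrow> trans (S x)"

primrec forces :: "'w rel \<Rightarrow> ('w \<Rightarrow> 'w rel) \<Rightarrow> (nat \<Rightarrow> 'w set) \<Rightarrow> 'w \<Rightarrow> fm \<Rightarrow> bool" where
  "forces R S V w (Var p) \<longleftrightarrow> w \<in> V p"
| "forces R S V w \<^bold>\<bottom> \<longleftrightarrow> False"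
| "forces R S V w (A \<^bold>\<longrightarrow> B) \<longleftrightarrow> (forces R S V w A \<longrightarrow> forces R S V w B)"
| "forces R S V w (\<^bold>\<box> A) \<longleftrightarrow> (\<forall>u. (w, u) \<in> R \<longrightarrow> forces R S V u A)"
| "forces R S V w (A \<rhd> B) \<longleftrightarrow>
     (\<forall>u. (w, u) \<in> R \<and> forces R S V u A \<longrightarrow> (\<exists>v. (u, v) \<in> S w \<and> forces R S V v B))"

definition M0_frame_condition :: "'w rel \<Rightarrow> ('w \<Rightarrow> 'w rel) \<Rightarrow> bool" where
  "M0_frame_condition R S \<longleftrightarrow>
     (\<forall>w x y y' z. (w, x) \<in> R \<and> (x, y) \<in> R \<and> (y, y') \<in> S w \<and> (y', z) \<in> R \<longrightarrow> (x, z) \<in> R)"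

definition M0_valid :: "'w itself \<Rightarrow> fm \<Rightarrow> bool" where
  "M0_valid _ A \<longleftrightarrow>
     (\<forall>(W :: 'w set) R S V. IL_frame W R S \<and> M0_frame_condition R S \<longrightarrow>
        (\<forall>w\<in>W. forces R S V w A))"

text \<open>HOL formulas cannot quantify over types. Since frames are countable, nothing is lost
  by taking sets of worlds to be subsets of \<open>nat\<close>: validity there yields validity in all
  frames over every type.\<close>

lemma M0_valid_nat_imp_M0_valid:
  assumes "M0_valid TYPE(nat) A"
  shows "M0_valid TYPE('w) A"
  unfolding M0_valid_def
proof (intro allI impI ballI, elim conjE)
  fix W :: "'w set" and R S w and V :: "nat \<Rightarrow> 'w set"
  assume fr: "IL_frame W R S" and m: "M0_frame_condition R S" and w: "w \<in> W"
  interpret IL_frame W R S by (rule fr)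
  obtain f :: "'w \<Rightarrow> nat" where f: "inj_on f W"
    using W_countable unfolding countable_def by blast
  define N where "N = f ` W"
  define g where "g = inv_into W f"
  have gf: "g (f x) = x" if "x \<in> W" for x
    using f that by (simp add: g_def)
  then have gN: "g a \<in> W" if "a \<in> N" for a
    using that by (auto simp: N_def)
  have ex: "\<exists>a\<in>N. g a = x" if "x \<in> W" for x
    using gf that by (auto simp: N_def)
  define R' where "R' = {(a, b). a \<in> N \<and> b \<in> N \<and> (g a, g b) \<in> R}"
  define S' where "S' = (\<lambda>a. {(b, c). b \<in> N \<and> c \<in> N \<and> (g b, g c) \<in> S (g a)})"
  define V' where "V' = (\<lambda>p. {a. g a \<in> V p})"
  have RW: "x \<in> W" "y \<in> W" if "(x, y) \<in> R" for x y
    using R_on_W that by auto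
  have SW: "y \<in> W" "z \<in> W" if "x \<in> W" "(y, z) \<in> S x" for x y z
    using S_imp_R[OF that] RW by blast+
  have "IL_frame N R' S'"
  proof
    show "N \<noteq> {}" "countable N" using W_nonempty W_countable by (auto simp: N_def)
    show "R' \<subseteq> N \<times> N" by (auto simp: R'_def)
    show "wf (R'\<inverse>)"
      by (rule wf_subset[OF wf_inv_image[OF R_conv_wf, of g]]) (auto simp: R'_def)
    show "trans R'"
      using R_trans unfolding R'_def trans_def by blast
    show "trans (S' a)" if "a \<in> N" for a
      using S_trans[OF gN[OF that]] unfolding S'_def trans_def by blast
    show "(a, b) \<in> R' \<and> (a, c) \<in> R'" if "a \<in> N" "(b, c) \<in> S' a" for a b c
      using S_imp_R[OF gN[OF that(1)]] that unfolding S'_def R'_def by blast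
  qed (auto simp: R'_def S'_def S_refl R_imp_S)
  moreover have "M0_frame_condition R' S'"
    using m unfolding M0_frame_condition_def R'_def S'_def by blast
  moreover obtain a where a: "a \<in> N" "g a = w" using ex w by blast
  ultimately have "forces R' S' V' a A"
    using assms unfolding M0_valid_def by blast
  moreover have "forces R' S' V' a B \<longleftrightarrow> forces R S V (g a) B" if "a \<in> N" for a B
    using that
  proof (induction B arbitrary: a)
    case (Box B)
    have "forces R' S' V' a (\<^bold>\<box> B) \<longleftrightarrow> (\<forall>b\<in>N. (g a, g b) \<in> R \<longrightarrow> forces R S V (g b) B)"
      using Box by (auto simp: R'_def)
    then show ?case using ex RW by (metis forces.simps(4))
  next
    case (Rhd B C)
    have 1: "(\<exists>c. (b, c) \<in> S' a \<and> forces R' S' V' c C) \<longleftrightarrow>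
          (\<exists>v. (g b, v) \<in> S (g a) \<and> forces R S V v C)" if "b \<in> N" for b
    proof -
      have "(\<exists>c. (b, c) \<in> S' a \<and> forces R' S' V' c C) \<longleftrightarrow>
          (\<exists>c\<in>N. (g b, g c) \<in> S (g a) \<and> forces R S V (g c) C)"
        using that Rhd.IH(2) by (auto simp: S'_def)
      then show ?thesis using ex SW(2)[OF gN[OF Rhd.prems]] by metis
    qed
    have "forces R' S' V' a (B \<rhd> C) \<longleftrightarrow> (\<forall>b\<in>N. (g a, g b) \<in> R \<and> forces R' S' V' b B
        \<longrightarrow> (\<exists>c. (b, c) \<in> S' a \<and> forces R' S' V' c C))"
      unfolding forces.simps R'_def using Rhd.prems by blast
    also have "\<dots> \<longleftrightarrow> (\<forall>b\<in>N. (g a, g b) \<in> R \<and> forces R S V (g b) B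
        \<longrightarrow> (\<exists>v. (g b, v) \<in> S (g a) \<and> forces R S V v C))"
      by (intro ball_cong refl) (simp only: Rhd.IH(1) 1)
    also have "\<dots> \<longleftrightarrow> forces R S V (g a) (B \<rhd> C)"
      unfolding forces.simps using ex RW by metis
    finally show ?case .
  qed (auto simp: V'_def)
  ultimately show "forces R S V w A" using a by blast
qed

end

theory Submission imports Defs begin

text \<open>If \<open>\<phi>\<close> is not derivable, a countermodel is built from a tree of worlds, each carrying a
  maximal consistent set: a world \<open>w\<close> gets a child for every \<open>A \<rhd> B\<close> it refutes, and a child
  for every \<open>C \<rhd> D\<close> it contains together with an \<open>R\<close>-successor \<open>t\<close> of \<open>w\<close> forcing \<open>C\<close>.
  The accessibility relation is the least one that contains the tree and obeys transitivity
  and the frame condition.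

  Criticality is replaced by assuring labels (Bilkova, Goris, Joosten): \<open>\<Gamma>\<close> is followed
  \<open>T\<close>-assuringly by \<open>\<Delta>\<close> if \<open>\<Delta>\<close> contains \<open>\<not>A\<close> and \<open>\<box>\<not>A\<close> whenever \<open>\<Gamma>\<close> contains
  \<open>A \<rhd> \<Or>\<not>T'\<close> with \<open>T' \<subseteq> T\<close> finite. The scheme \<open>M\<^sub>0\<close> allows one to add the boxed formulas of an
  intermediate world to a label, and a child answering \<open>C \<rhd> D\<close> for \<open>t\<close> inherits the
  label of \<open>t\<close>; so it contains every boxed formula that the frame condition demands. What has to
  be checked is that several ways of reaching a world never demand incomparable labels. This
  holds because the worlds that \<open>R\<close>-precede a given one turn out to be linearly ordered.\<close>


section \<open>Maximal consistent sets\<close>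

lemma ILM0_taut: "(\<And>v. tval v A) \<Longrightarrow> A \<in> ILM0"
  unfolding ILM0_def by (rule IL_plus.Taut) (simp add: tautology_def)

lemma ILM0_MP: "A \<^bold>\<longrightarrow> B \<in> ILM0 \<Longrightarrow> A \<in> ILM0 \<Longrightarrow> B \<in> ILM0"
  unfolding ILM0_def by (rule IL_plus.MP)

lemma ILM0_Nec: "A \<in> ILM0 \<Longrightarrow> \<^bold>\<box> A \<in> ILM0"
  unfolding ILM0_def by (rule IL_plus.Nec)

lemma ILM0_M0: "(A \<rhd> B) \<^bold>\<longrightarrow> ((\<^bold>\<diamond> A \<^bold>\<and> \<^bold>\<box> C) \<rhd> (B \<^bold>\<and> \<^bold>\<box> C)) \<in> ILM0"
  unfolding ILM0_def M0_axioms_def by (rule IL_plus.Ax) blast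

definition mcs :: "fm set \<Rightarrow> bool" where
  "mcs \<Gamma> \<longleftrightarrow> ILM0 \<subseteq> \<Gamma> \<and> (\<forall>A B. (A \<^bold>\<longrightarrow> B) \<in> \<Gamma> \<longleftrightarrow> (A \<in> \<Gamma> \<longrightarrow> B \<in> \<Gamma>)) \<and> \<^bold>\<bottom> \<notin> \<Gamma>"

lemma mcs_Imp: "mcs \<Gamma> \<Longrightarrow> (A \<^bold>\<longrightarrow> B) \<in> \<Gamma> \<longleftrightarrow> (A \<in> \<Gamma> \<longrightarrow> B \<in> \<Gamma>)"
  and mcs_Bot: "mcs \<Gamma> \<Longrightarrow> \<^bold>\<bottom> \<notin> \<Gamma>"
  and mcs_thm: "mcs \<Gamma> \<Longrightarrow> A \<in> ILM0 \<Longrightarrow> A \<in> \<Gamma>"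
  unfolding mcs_def by blast+

lemmas mcs_simps = mcs_Imp mcs_Bot

definition derives :: "fm set \<Rightarrow> fm \<Rightarrow> bool" where
  "derives X A \<longleftrightarrow> (\<exists>xs. set xs \<subseteq> X \<and> foldr (\<^bold>\<longrightarrow>) xs A \<in> ILM0)"

lemma tval_foldr_Imp: "tval v (foldr (\<^bold>\<longrightarrow>) xs A) \<longleftrightarrow> ((\<forall>x\<in>set xs. tval v x) \<longrightarrow> tval v A)"
  by (induction xs) auto

lemma derives_insert:
  assumes "derives (insert A X) B" shows "derives X (A \<^bold>\<longrightarrow> B)"
proof -
  obtain xs where xs: "set xs \<subseteq> insert A X" "foldr (\<^bold>\<longrightarrow>) xs B \<in> ILM0"
    using assms by (auto simp: derives_def)
  have "foldr (\<^bold>\<longrightarrow>) xs B \<^bold>\<longrightarrow> foldr (\<^bold>\<longrightarrow>) (filter (\<lambda>x. x \<noteq> A) xs) (A \<^bold>\<longrightarrow> B) \<in> ILM0"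
    by (rule ILM0_taut) (auto simp: tval_foldr_Imp)
  then have "foldr (\<^bold>\<longrightarrow>) (filter (\<lambda>x. x \<noteq> A) xs) (A \<^bold>\<longrightarrow> B) \<in> ILM0"
    using xs(2) ILM0_MP by blast
  then show ?thesis using xs(1) unfolding derives_def by (intro exI conjI) auto
qed

lemma derives_MP:
  assumes "derives X (A \<^bold>\<longrightarrow> B)" "derives X A" shows "derives X B"
proof -
  obtain xs ys where xs: "set xs \<subseteq> X" "foldr (\<^bold>\<longrightarrow>) xs (A \<^bold>\<longrightarrow> B) \<in> ILM0"
    and ys: "set ys \<subseteq> X" "foldr (\<^bold>\<longrightarrow>) ys A \<in> ILM0"
    using assms by (auto simp: derives_def)
  have "foldr (\<^bold>\<longrightarrow>) xs (A \<^bold>\<longrightarrow> B) \<^bold>\<longrightarrow> foldr (\<^bold>\<longrightarrow>) ys A \<^bold>\<longrightarrow> foldr (\<^bold>\<longrightarrow>) (xs @ ys) B \<in> ILM0"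
    by (rule ILM0_taut) (auto simp: tval_foldr_Imp simp del: foldr_append)
  then have "foldr (\<^bold>\<longrightarrow>) (xs @ ys) B \<in> ILM0"
    using xs(2) ys(2) ILM0_MP by blast
  then show ?thesis using xs(1) ys(1) unfolding derives_def
    by (metis le_sup_iff set_append)
qed

lemma derives_thm: "A \<in> ILM0 \<Longrightarrow> derives X A"
  unfolding derives_def by (intro exI[of _ "[]"]) simp

lemma derives_mem: "A \<in> X \<Longrightarrow> derives X A"
  unfolding derives_def by (intro exI[of _ "[A]"]) (auto intro: ILM0_taut)

lemma Lindenbaum:
  assumes "\<not> derives X \<^bold>\<bottom>"
  obtains \<Gamma> where "mcs \<Gamma>" "X \<subseteq> \<Gamma>"
proof -
  define \<C> where "\<C> = {Y. X \<subseteq> Y \<and> \<not> derives Y \<^bold>\<bottom>}"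
  have "\<exists>M\<in>\<C>. \<forall>Y\<in>\<C>. M \<subseteq> Y \<longrightarrow> Y = M"
  proof (rule subset_Zorn_nonempty)
    show "\<C> \<noteq> {}" using assms by (auto simp: \<C>_def)
  next
    fix \<K> assume ne: "\<K> \<noteq> {}" and ch: "subset.chain \<C> \<K>"
    have sub: "\<K> \<subseteq> \<C>" using ch by (simp add: subset.chain_def)
    have "\<not> derives (\<Union>\<K>) \<^bold>\<bottom>"
    proof
      assume "derives (\<Union>\<K>) \<^bold>\<bottom>"
      then obtain xs where xs: "set xs \<subseteq> \<Union>\<K>" "foldr (\<^bold>\<longrightarrow>) xs \<^bold>\<bottom> \<in> ILM0"
        by (auto simp: derives_def)
      obtain Y where "Y \<in> \<K>" "set xs \<subseteq> Y"
        using finite_subset_Union_chain[OF _ xs(1) ne ch] by auto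
      then show False using xs(2) sub unfolding \<C>_def derives_def by blast
    qed
    then show "\<Union>\<K> \<in> \<C>" using ne sub by (auto simp: \<C>_def)
  qed
  then obtain M where "M \<in> \<C>" and M_max: "\<forall>Y\<in>\<C>. M \<subseteq> Y \<longrightarrow> Y = M" by blast
  then have M: "X \<subseteq> M" "\<not> derives M \<^bold>\<bottom>" by (auto simp: \<C>_def)
  have max: "Y = M" if "M \<subseteq> Y" "\<not> derives Y \<^bold>\<bottom>" for Y
    using that M(1) M_max by (auto simp: \<C>_def)
  have step: "derives M (A \<^bold>\<longrightarrow> \<^bold>\<bottom>)" if "A \<notin> M" for A
    using max[of "insert A M"] that derives_insert by blast
  have closed: "A \<in> M" if "derives M A" for A
    using step[of A] that M(2) derives_MP by blast
  have "(A \<^bold>\<longrightarrow> B) \<in> M \<longleftrightarrow> (A \<in> M \<longrightarrow> B \<in> M)" for A B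
  proof
    assume "(A \<^bold>\<longrightarrow> B) \<in> M"
    then show "A \<in> M \<longrightarrow> B \<in> M" using closed derives_MP derives_mem by blast
  next
    assume "A \<in> M \<longrightarrow> B \<in> M"
    moreover have "derives M (\<^bold>\<not> A \<^bold>\<longrightarrow> A \<^bold>\<longrightarrow> B)" "derives M (B \<^bold>\<longrightarrow> A \<^bold>\<longrightarrow> B)"
      by (rule derives_thm, rule ILM0_taut, simp)+
    ultimately show "(A \<^bold>\<longrightarrow> B) \<in> M"
      using step closed derives_MP derives_mem by meson
  qed
  moreover have "\<^bold>\<bottom> \<notin> M" using M(2) derives_mem by blast
  ultimately have "mcs M" unfolding mcs_def using closed derives_thm by blast
  then show thesis using M(1) that by blast
qed

text \<open>Lets later derivability claims be proved by membership arguments inside an arbitrary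
  maximal consistent set instead of Hilbert-style derivations.\<close>

lemma ILM0_iff_mcs: "A \<in> ILM0 \<longleftrightarrow> (\<forall>\<Gamma>. mcs \<Gamma> \<longrightarrow> A \<in> \<Gamma>)"
proof (intro iffI allI impI)
  assume *: "\<forall>\<Gamma>. mcs \<Gamma> \<longrightarrow> A \<in> \<Gamma>"
  have "derives {\<^bold>\<not> A} \<^bold>\<bottom>"
  proof (rule ccontr)
    assume "\<not> derives {\<^bold>\<not> A} \<^bold>\<bottom>"
    then obtain \<Gamma> where "mcs \<Gamma>" "{\<^bold>\<not> A} \<subseteq> \<Gamma>" by (rule Lindenbaum)
    then show False using * by (auto simp: mcs_simps)
  qed
  then have "derives {} (\<^bold>\<not> \<^bold>\<not> A)" by (rule derives_insert)
  then have "\<^bold>\<not> \<^bold>\<not> A \<in> ILM0" by (simp add: derives_def)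
  moreover have "\<^bold>\<not> \<^bold>\<not> A \<^bold>\<longrightarrow> A \<in> ILM0" by (rule ILM0_taut) simp
  ultimately show "A \<in> ILM0" using ILM0_MP by blast
qed (simp add: mcs_thm)


section \<open>Modal reasoning inside a maximal consistent set\<close>

context
  fixes \<Gamma> assumes mcs: "mcs \<Gamma>"
begin

lemma mcs_L1: "\<^bold>\<box> (A \<^bold>\<longrightarrow> B) \<in> \<Gamma> \<Longrightarrow> \<^bold>\<box> A \<in> \<Gamma> \<Longrightarrow> \<^bold>\<box> B \<in> \<Gamma>"
  using mcs_thm[OF mcs IL_plus.L1[of A B M0_axioms, folded ILM0_def]] by (simp add: mcs_simps mcs)

lemma mcs_Box_mono: "A \<^bold>\<longrightarrow> B \<in> ILM0 \<Longrightarrow> \<^bold>\<box> A \<in> \<Gamma> \<Longrightarrow> \<^bold>\<box> B \<in> \<Gamma>"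
  using mcs_L1 mcs_thm[OF mcs ILM0_Nec] by blast

lemma mcs_L3: "\<^bold>\<box> (\<^bold>\<box> A \<^bold>\<longrightarrow> A) \<in> \<Gamma> \<Longrightarrow> \<^bold>\<box> A \<in> \<Gamma>"
  using mcs_thm[OF mcs IL_plus.L3[of A M0_axioms, folded ILM0_def]] by (simp add: mcs_simps mcs)

lemma mcs_J1: "\<^bold>\<box> (A \<^bold>\<longrightarrow> B) \<in> \<Gamma> \<Longrightarrow> (A \<rhd> B) \<in> \<Gamma>"
  using mcs_thm[OF mcs IL_plus.J1[of A B M0_axioms, folded ILM0_def]] by (simp add: mcs_simps mcs)

lemma mcs_Rhd_thm: "A \<^bold>\<longrightarrow> B \<in> ILM0 \<Longrightarrow> (A \<rhd> B) \<in> \<Gamma>"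
  using mcs_J1 mcs_thm[OF mcs ILM0_Nec] by blast

lemma mcs_J2: "(A \<rhd> B) \<in> \<Gamma> \<Longrightarrow> (B \<rhd> C) \<in> \<Gamma> \<Longrightarrow> (A \<rhd> C) \<in> \<Gamma>"
  using mcs_thm[OF mcs IL_plus.J2[of A B C M0_axioms, folded ILM0_def]]
  by (simp add: mcs_simps mcs)

lemma mcs_J3: "(A \<rhd> C) \<in> \<Gamma> \<Longrightarrow> (B \<rhd> C) \<in> \<Gamma> \<Longrightarrow> ((A \<^bold>\<or> B) \<rhd> C) \<in> \<Gamma>"
  using mcs_thm[OF mcs IL_plus.J3[of A C B M0_axioms, folded ILM0_def]]
  by (simp add: mcs_simps mcs)

lemma mcs_J5: "(\<^bold>\<diamond> A \<rhd> A) \<in> \<Gamma>"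
  using mcs_thm[OF mcs IL_plus.J5[of A M0_axioms, folded ILM0_def]] .

lemma mcs_Rhd_Bot: "(A \<rhd> \<^bold>\<bottom>) \<in> \<Gamma> \<Longrightarrow> \<^bold>\<box> \<^bold>\<not> A \<in> \<Gamma>"
  using mcs_thm[OF mcs IL_plus.J4[of A "\<^bold>\<bottom>" M0_axioms, folded ILM0_def]]
    mcs_thm[OF mcs ILM0_Nec[OF ILM0_taut[of "\<^bold>\<not> \<^bold>\<bottom>"]]] by (auto simp: mcs_simps mcs)

lemma mcs_Or_Dia_Rhd: "((A \<^bold>\<or> \<^bold>\<diamond> A) \<rhd> A) \<in> \<Gamma>"
  by (rule mcs_J3[OF mcs_Rhd_thm[OF ILM0_taut] mcs_J5]) simp

lemma mcs_M0: "(A \<rhd> B) \<in> \<Gamma> \<Longrightarrow> ((\<^bold>\<diamond> A \<^bold>\<and> \<^bold>\<box> C) \<rhd> (B \<^bold>\<and> \<^bold>\<box> C)) \<in> \<Gamma>"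
  using mcs_thm[OF mcs ILM0_M0[of A B C]] by (simp add: mcs_simps mcs)

end

text \<open>With X for the right-hand side, Neg X yields Box Neg A -> Neg A, so L3 turns Box Neg X
  into Box Neg A. Hence A implies X or Dia X, and (X or Dia X) Rhd X by J3 and J5.\<close>

lemma mcs_Rhd_Loeb:
  assumes "mcs \<Gamma>" shows "(A \<rhd> (A \<^bold>\<and> \<^bold>\<box> \<^bold>\<not> A)) \<in> \<Gamma>"
proof -
  let ?X = "A \<^bold>\<and> \<^bold>\<box> \<^bold>\<not> A"
  have "A \<^bold>\<longrightarrow> (?X \<^bold>\<or> \<^bold>\<diamond> ?X) \<in> ILM0"
    unfolding ILM0_iff_mcs
  proof (intro allI impI)
    fix \<Delta> assume \<Delta>: "mcs \<Delta>"
    have "\<^bold>\<box> \<^bold>\<not> A \<in> \<Delta>" if "\<^bold>\<box> \<^bold>\<not> ?X \<in> \<Delta>"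
      by (rule mcs_L3[OF \<Delta>], rule mcs_Box_mono[OF \<Delta> ILM0_taut that]) auto
    then show "A \<^bold>\<longrightarrow> (?X \<^bold>\<or> \<^bold>\<diamond> ?X) \<in> \<Delta>" using \<Delta> by (auto simp: mcs_simps)
  qed
  then show ?thesis using assms mcs_J2 mcs_Rhd_thm mcs_Or_Dia_Rhd by blast
qed


section \<open>Assuring labels\<close>

definition disj :: "fm list \<Rightarrow> fm" where
  "disj xs = foldr (\<lambda>\<sigma> D. \<^bold>\<not> \<sigma> \<^bold>\<or> D) xs \<^bold>\<bottom>"

lemma tval_disj: "tval v (disj xs) \<longleftrightarrow> (\<exists>\<sigma>\<in>set xs. \<not> tval v \<sigma>)"
  unfolding disj_def by (induction xs) auto

lemma mcs_disj: "mcs \<Gamma> \<Longrightarrow> disj xs \<in> \<Gamma> \<longleftrightarrow> (\<exists>\<sigma>\<in>set xs. \<sigma> \<notin> \<Gamma>)"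
  unfolding disj_def by (induction xs) (auto simp: mcs_simps)

definition assured :: "fm set \<Rightarrow> fm set \<Rightarrow> fm set" where
  "assured \<Gamma> T = {A. \<exists>xs. set xs \<subseteq> T \<and> (A \<rhd> disj xs) \<in> \<Gamma>}"

definition assuring :: "fm set \<Rightarrow> fm set \<Rightarrow> fm set \<Rightarrow> bool" where
  "assuring \<Gamma> T \<Delta> \<longleftrightarrow> (\<forall>A\<in>assured \<Gamma> T. \<^bold>\<not> A \<in> \<Delta> \<and> \<^bold>\<box> \<^bold>\<not> A \<in> \<Delta>)"

definition boxes :: "fm set \<Rightarrow> fm set" where
  "boxes \<Gamma> = {\<^bold>\<box> A | A. \<^bold>\<box> A \<in> \<Gamma>}"

lemma boxes_iff: "\<^bold>\<box> A \<in> boxes \<Gamma> \<longleftrightarrow> \<^bold>\<box> A \<in> \<Gamma>"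
  by (auto simp: boxes_def)

lemma assured_mono: "T \<subseteq> T' \<Longrightarrow> assured \<Gamma> T \<subseteq> assured \<Gamma> T'"
  unfolding assured_def by blast

lemma assuring_mono: "assuring \<Gamma> T \<Delta> \<Longrightarrow> T' \<subseteq> T \<Longrightarrow> assuring \<Gamma> T' \<Delta>"
  using assured_mono unfolding assuring_def by blast

text \<open>With \<open>assured_Or\<close> and \<open>assured_Bot\<close> this makes
  \<open>assured\<close> an ideal for the preorder given by \<open>Rhd\<close>, so finitely many
  members can be replaced by their disjunction.\<close>

lemma assured_Rhd: "mcs \<Gamma> \<Longrightarrow> (A \<rhd> B) \<in> \<Gamma> \<Longrightarrow> B \<in> assured \<Gamma> T \<Longrightarrow> A \<in> assured \<Gamma> T"
  unfolding assured_def using mcs_J2 by blast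

lemma assured_Or:
  assumes "mcs \<Gamma>" "A \<in> assured \<Gamma> T" "B \<in> assured \<Gamma> T"
  shows "A \<^bold>\<or> B \<in> assured \<Gamma> T"
proof -
  obtain xs ys where xs: "set xs \<subseteq> T" "(A \<rhd> disj xs) \<in> \<Gamma>"
    and ys: "set ys \<subseteq> T" "(B \<rhd> disj ys) \<in> \<Gamma>"
    using assms by (auto simp: assured_def)
  have "(disj xs \<rhd> disj (xs @ ys)) \<in> \<Gamma>" "(disj ys \<rhd> disj (xs @ ys)) \<in> \<Gamma>"
    by (rule mcs_Rhd_thm[OF assms(1) ILM0_taut], auto simp: tval_disj)+
  then have "((A \<^bold>\<or> B) \<rhd> disj (xs @ ys)) \<in> \<Gamma>"
    using xs ys mcs_J2 mcs_J3 assms(1) by metis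
  then show ?thesis using xs ys unfolding assured_def by (metis (mono_tags) mem_Collect_eq le_sup_iff set_append)
qed

lemma assured_Bot: "mcs \<Gamma> \<Longrightarrow> \<^bold>\<bottom> \<in> assured \<Gamma> T"
  unfolding assured_def using mcs_Rhd_thm[OF _ ILM0_taut, of \<Gamma> "\<^bold>\<bottom>" "disj []"]
  by (auto intro!: exI[of _ "[]"])

lemma assured_Neg: "mcs \<Gamma> \<Longrightarrow> \<sigma> \<in> T \<Longrightarrow> \<^bold>\<not> \<sigma> \<in> assured \<Gamma> T"
  unfolding assured_def using mcs_Rhd_thm[OF _ ILM0_taut, of \<Gamma> "\<^bold>\<not> \<sigma>" "disj [\<sigma>]"]
  by (auto intro!: exI[of _ "[\<sigma>]"] simp: tval_disj)

text \<open>For the label consisting of Neg B alone, assuringness amounts to the classical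
  B-criticality: every \<open>disj xs\<close> over it implies B.\<close>

lemma critical_not_assured:
  assumes "mcs \<Gamma>" "(A \<rhd> B) \<notin> \<Gamma>" shows "A \<notin> assured \<Gamma> {\<^bold>\<not> B}"
proof
  assume "A \<in> assured \<Gamma> {\<^bold>\<not> B}"
  then obtain xs where xs: "set xs \<subseteq> {\<^bold>\<not> B}" "(A \<rhd> disj xs) \<in> \<Gamma>"
    by (auto simp: assured_def)
  have "disj xs \<^bold>\<longrightarrow> B \<in> ILM0" by (rule ILM0_taut) (use xs(1) in \<open>auto simp: tval_disj\<close>)
  then show False using assms xs(2) mcs_J2 mcs_Rhd_thm by blast
qed

lemma assuring_label:
  assumes "mcs \<Gamma>" "mcs \<Delta>" "assuring \<Gamma> T \<Delta>" shows "T \<subseteq> \<Delta>"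
  using assms assured_Neg unfolding assuring_def by (fastforce simp: mcs_simps)

text \<open>Box A gives (Neg A) Rhd Bot, and Bot is assured under every label, even the empty
  one.\<close>

lemma assuring_Box:
  assumes "mcs \<Gamma>" "mcs \<Delta>" "assuring \<Gamma> T \<Delta>" "\<^bold>\<box> A \<in> \<Gamma>"
  shows "A \<in> \<Delta>" "\<^bold>\<box> A \<in> \<Delta>"
proof -
  have "\<^bold>\<box> (\<^bold>\<not> A \<^bold>\<longrightarrow> \<^bold>\<bottom>) \<in> \<Gamma>"
    by (rule mcs_Box_mono[OF assms(1) ILM0_taut assms(4)]) simp
  then have "\<^bold>\<not> A \<in> assured \<Gamma> T"
    using assured_Rhd[OF assms(1) mcs_J1 assured_Bot] assms(1) by blast
  then have *: "\<^bold>\<not> \<^bold>\<not> A \<in> \<Delta>" "\<^bold>\<box> \<^bold>\<not> \<^bold>\<not> A \<in> \<Delta>"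
    using assms(3) unfolding assuring_def by blast+
  show "A \<in> \<Delta>" using * assms by (simp add: mcs_simps)
  show "\<^bold>\<box> A \<in> \<Delta>" by (rule mcs_Box_mono[OF assms(2) ILM0_taut *(2)]) simp
qed

text \<open>Compactness: an inconsistency uses finitely many assured formulas, which one disjunction
  A absorbs, so B and Box Neg B imply A or Dia A. Then B Rhd A by \<open>mcs_Rhd_Loeb\<close> and
  J5, and B would be assured. The extra Box Neg B serves converse well-foundedness.\<close>

lemma assuring_exists:
  assumes \<Gamma>: "mcs \<Gamma>" and B: "B \<notin> assured \<Gamma> T"
  shows "\<exists>\<Delta>. mcs \<Delta> \<and> assuring \<Gamma> T \<Delta> \<and> B \<in> \<Delta> \<and> \<^bold>\<box> \<^bold>\<not> B \<in> \<Delta>"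
proof -
  let ?I = "assured \<Gamma> T"
  let ?X = "{B, \<^bold>\<box> \<^bold>\<not> B} \<union> ((\<lambda>A. \<^bold>\<not> A) ` ?I \<union> (\<lambda>A. \<^bold>\<box> \<^bold>\<not> A) ` ?I)"
  have "\<not> derives ?X \<^bold>\<bottom>"
  proof
    assume "derives ?X \<^bold>\<bottom>"
    then obtain zs where zs: "set zs \<subseteq> ?X" "foldr (\<^bold>\<longrightarrow>) zs \<^bold>\<bottom> \<in> ILM0"
      by (auto simp: derives_def)
    have "\<exists>A\<in>?I. \<forall>\<Delta>. mcs \<Delta> \<longrightarrow> {B, \<^bold>\<box> \<^bold>\<not> B, \<^bold>\<not> A, \<^bold>\<box> \<^bold>\<not> A} \<subseteq> \<Delta> \<longrightarrow> set zs \<subseteq> \<Delta>"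
      using zs(1)
    proof (induction zs)
      case Nil
      then show ?case using assured_Bot[OF \<Gamma>] by auto
    next
      case (Cons z zs)
      then obtain A where A: "A \<in> ?I"
        "\<And>\<Delta>. mcs \<Delta> \<Longrightarrow> {B, \<^bold>\<box> \<^bold>\<not> B, \<^bold>\<not> A, \<^bold>\<box> \<^bold>\<not> A} \<subseteq> \<Delta> \<Longrightarrow> set zs \<subseteq> \<Delta>" by auto
      obtain A' where A': "A' \<in> ?I" "z \<in> {B, \<^bold>\<box> \<^bold>\<not> B, \<^bold>\<not> A', \<^bold>\<box> \<^bold>\<not> A'}"
        using Cons.prems A(1) by auto
      have "{\<^bold>\<not> A, \<^bold>\<box> \<^bold>\<not> A, \<^bold>\<not> A', \<^bold>\<box> \<^bold>\<not> A'} \<subseteq> \<Delta>"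
        if \<Delta>: "mcs \<Delta>" and *: "\<^bold>\<not> (A \<^bold>\<or> A') \<in> \<Delta>" "\<^bold>\<box> \<^bold>\<not> (A \<^bold>\<or> A') \<in> \<Delta>" for \<Delta>
      proof -
        have "\<^bold>\<box> \<^bold>\<not> A \<in> \<Delta>" "\<^bold>\<box> \<^bold>\<not> A' \<in> \<Delta>"
          by (rule mcs_Box_mono[OF \<Delta> ILM0_taut *(2)], simp)+
        then show ?thesis using \<Delta> *(1) by (auto simp: mcs_simps)
      qed
      then show ?case using A A' assured_Or[OF \<Gamma> A(1) A'(1)]
        by (intro bexI[of _ "A \<^bold>\<or> A'"]) auto
    qed
    then obtain A where A: "A \<in> ?I"
      "\<And>\<Delta>. mcs \<Delta> \<Longrightarrow> {B, \<^bold>\<box> \<^bold>\<not> B, \<^bold>\<not> A, \<^bold>\<box> \<^bold>\<not> A} \<subseteq> \<Delta> \<Longrightarrow> set zs \<subseteq> \<Delta>" by blast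
    have zs_inc: "\<not> set zs \<subseteq> \<Delta>" if "mcs \<Delta>" for \<Delta>
    proof
      assume "set zs \<subseteq> \<Delta>"
      moreover have "foldr (\<^bold>\<longrightarrow>) zs \<^bold>\<bottom> \<in> \<Delta>" using that zs(2) mcs_thm by blast
      ultimately show False using that by (induction zs) (auto simp: mcs_simps)
    qed
    have "B \<^bold>\<and> \<^bold>\<box> \<^bold>\<not> B \<^bold>\<longrightarrow> (A \<^bold>\<or> \<^bold>\<diamond> A) \<in> ILM0"
      unfolding ILM0_iff_mcs using A(2) zs_inc by (simp add: mcs_simps) blast
    then have "(B \<rhd> A) \<in> \<Gamma>"
      using mcs_J2 mcs_Rhd_Loeb mcs_Rhd_thm mcs_Or_Dia_Rhd \<Gamma> by meson
    then show False using B A(1) assured_Rhd[OF \<Gamma>] by blast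
  qed
  then obtain \<Delta> where "mcs \<Delta>" "?X \<subseteq> \<Delta>" by (rule Lindenbaum)
  then show ?thesis unfolding assuring_def by blast
qed

text \<open>Packs finitely many boxed formulas into a single box, since an instance of the scheme
  carries only one formula C.\<close>

lemma boxes_conj:
  assumes "mcs \<Gamma>" "set es \<subseteq> boxes \<Gamma>"
  shows "\<exists>E. \<^bold>\<box> E \<in> \<Gamma> \<and> (\<forall>\<Delta>. mcs \<Delta> \<longrightarrow> \<^bold>\<box> E \<in> \<Delta> \<longrightarrow> set es \<subseteq> \<Delta>)"
  using assms(2)
proof (induction es)
  case Nil
  have "\<^bold>\<box> (\<^bold>\<not> \<^bold>\<bottom>) \<in> \<Gamma>" by (rule mcs_thm[OF assms(1) ILM0_Nec[OF ILM0_taut]]) simp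
  then show ?case by auto
next
  case (Cons e es)
  then obtain E where E: "\<^bold>\<box> E \<in> \<Gamma>" "\<And>\<Delta>. mcs \<Delta> \<Longrightarrow> \<^bold>\<box> E \<in> \<Delta> \<Longrightarrow> set es \<subseteq> \<Delta>" by auto
  obtain F where F: "e = \<^bold>\<box> F" "\<^bold>\<box> F \<in> \<Gamma>" using Cons.prems by (auto simp: boxes_def)
  have "\<^bold>\<box> (F \<^bold>\<longrightarrow> E \<^bold>\<and> F) \<in> \<Gamma>"
    by (rule mcs_Box_mono[OF assms(1) ILM0_taut E(1)]) simp
  then have "\<^bold>\<box> (E \<^bold>\<and> F) \<in> \<Gamma>" using mcs_L1[OF assms(1)] F(2) by blast
  moreover have "\<^bold>\<box> E \<in> \<Delta>" "\<^bold>\<box> F \<in> \<Delta>" if "mcs \<Delta>" "\<^bold>\<box> (E \<^bold>\<and> F) \<in> \<Delta>" for \<Delta>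
    by (rule mcs_Box_mono[OF that(1) ILM0_taut that(2)], simp)+
  ultimately show ?case using E(2) F(1) by (intro exI[of _ "E \<^bold>\<and> F"]) auto
qed

text \<open>The only use of the axiom scheme \<open>M\<^sub>0\<close>.\<close>

lemma assured_boxes:
  assumes \<Gamma>: "mcs \<Gamma>" and \<Delta>: "mcs \<Delta>" and T: "assuring \<Gamma> T \<Delta>"
    and A: "A \<in> assured \<Gamma> (T \<union> boxes \<Delta>)"
  shows "\<^bold>\<box> \<^bold>\<not> A \<in> \<Delta>"
proof -
  obtain xs where xs: "set xs \<subseteq> T \<union> boxes \<Delta>" "(A \<rhd> disj xs) \<in> \<Gamma>"
    using A by (auto simp: assured_def)
  define ts es where "ts = filter (\<lambda>x. x \<in> T) xs" and "es = filter (\<lambda>x. x \<notin> T) xs"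
  have "set es \<subseteq> boxes \<Delta>" using xs(1) by (auto simp: es_def)
  then obtain E where E: "\<^bold>\<box> E \<in> \<Delta>" "\<And>\<Theta>. mcs \<Theta> \<Longrightarrow> \<^bold>\<box> E \<in> \<Theta> \<Longrightarrow> set es \<subseteq> \<Theta>"
    using boxes_conj[OF \<Delta>] by meson
  \<comment> \<open>Box E excludes failure of the entries in \<open>es\<close>. The scheme with C :=
    E therefore turns A Rhd \<open>disj xs\<close> into (Dia A and Box E) Rhd
    \<open>disj ts\<close>, whose right-hand side involves the label T only.\<close>
  have "disj xs \<^bold>\<and> \<^bold>\<box> E \<^bold>\<longrightarrow> disj ts \<in> ILM0"
    unfolding ILM0_iff_mcs using E(2)
    by (fastforce simp: mcs_simps mcs_disj ts_def es_def)
  then have "((\<^bold>\<diamond> A \<^bold>\<and> \<^bold>\<box> E) \<rhd> disj ts) \<in> \<Gamma>"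
    using mcs_J2 mcs_M0 mcs_Rhd_thm xs(2) \<Gamma> by meson
  then have "\<^bold>\<diamond> A \<^bold>\<and> \<^bold>\<box> E \<in> assured \<Gamma> T"
    unfolding assured_def by (auto intro!: exI[of _ ts] simp: ts_def)
  then show ?thesis using T E(1) \<Delta> unfolding assuring_def by (auto simp: mcs_simps)
qed


section \<open>The worlds\<close>

text \<open>\<open>Crit w A B\<close> is a child of \<open>w\<close> refuting \<open>A \<rhd> B\<close> at \<open>w\<close>, and \<open>Def w t C D\<close> is a child of
  \<open>w\<close> that answers \<open>C \<rhd> D\<close> at \<open>w\<close> for the world \<open>t\<close>, on which \<open>C\<close> holds. Recording the
  origin \<open>t\<close> is what makes the predecessors of every world linearly ordered (\<open>leq_linear\<close>).\<close>

datatype world = Root | Crit world fm fm | Def world world fm fm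

instance fm :: countable by countable_datatype
instance world :: countable by countable_datatype

definition child :: "world \<Rightarrow> world \<Rightarrow> bool" where
  "child p x \<longleftrightarrow> (\<exists>A B. x = Crit p A B) \<or> (\<exists>t C D. x = Def p t C D)"

lemma child_simps [simp]:
  "\<not> child p Root" "child p (Crit w A B) \<longleftrightarrow> p = w" "child p (Def w t C D) \<longleftrightarrow> p = w"
  by (auto simp: child_def)

text \<open>\<open>acc\<close> is the accessibility relation; \<open>lift x p\<close> holds when the frame condition and
  transitivity force everything above \<open>p\<close> to lie above \<open>x\<close>.\<close>

inductive acc :: "world \<Rightarrow> world \<Rightarrow> bool" and lift :: "world \<Rightarrow> world \<Rightarrow> bool" where
  acc_child: "child p z \<Longrightarrow> acc p z"
| acc_acc: "child p z \<Longrightarrow> acc x p \<Longrightarrow> acc x z"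
| acc_lift: "child p z \<Longrightarrow> lift x p \<Longrightarrow> acc x z"
| lift_self: "acc v x \<Longrightarrow> acc x t \<Longrightarrow> lift x (Def v t C D)"
| lift_acc: "acc v y \<Longrightarrow> acc y t \<Longrightarrow> acc x y \<Longrightarrow> lift x (Def v t C D)"
| lift_lift: "acc v y \<Longrightarrow> acc y t \<Longrightarrow> lift x y \<Longrightarrow> lift x (Def v t C D)"
| lift_Def: "lift x (Def v t C D) \<Longrightarrow> lift x (Def v (Def v t C D) C' D')"

text \<open>By \<open>acc_iff\<close>, \<open>leq x p\<close> says exactly that the children of
  \<open>p\<close> are accessible from \<open>x\<close>.\<close>

definition leq :: "world \<Rightarrow> world \<Rightarrow> bool" where
  "leq x y \<longleftrightarrow> x = y \<or> acc x y \<or> lift x y"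

lemma leqI: "acc x y \<Longrightarrow> leq x y" "lift x y \<Longrightarrow> leq x y"
  by (simp_all add: leq_def)

lemma acc_iff: "child p z \<Longrightarrow> acc x z \<longleftrightarrow> leq x p"
proof
  assume c: "child p z" and "acc x z"
  from this(2) show "leq x p"
    using c by cases (auto simp: child_def leq_def)
qed (auto simp: leq_def intro: acc_child acc_acc acc_lift)

lemma acc_size: "acc x y \<Longrightarrow> size x < size y"
  and lift_size: "lift x y \<Longrightarrow> size x < size y"
  by (induction rule: acc_lift.inducts) (auto simp: child_def)

lemma child_size: "child p x \<Longrightarrow> size p < size x"
  by (auto simp: child_def)

lemma leq_size: "leq x y \<Longrightarrow> size x \<le> size y"
  using acc_size lift_size by (fastforce simp: leq_def)

lemma lift_DefI: "acc v y \<Longrightarrow> acc y t \<Longrightarrow> leq x y \<Longrightarrow> lift x (Def v t C D)"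
  unfolding leq_def using lift_self lift_acc lift_lift by blast

text \<open>\<open>lift_self\<close>, \<open>lift_acc\<close> and \<open>lift_lift\<close> together
  admit every \<open>x\<close> with \<open>leq x y\<close> below the intermediate world
  \<open>y\<close>; this is why replacing \<open>x\<close> by something smaller never leaves the
  relations.\<close>

lemma acc_leq_trans:
  shows "acc y z \<Longrightarrow> (\<forall>x. leq x y \<longrightarrow> acc x z)"
    and lift_leq_trans: "lift y z \<Longrightarrow> (\<forall>x. leq x y \<longrightarrow> lift x z)"
proof (induction rule: acc_lift.inducts)
  case (lift_Def x v t C D C' D')
  then show ?case using acc_lift.lift_Def by blast
qed (auto simp: acc_iff intro: leqI lift_DefI lift_acc lift_lift)

lemma leq_acc: "leq x y \<Longrightarrow> acc y z \<Longrightarrow> acc x z"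
  using acc_leq_trans by blast

lemma leq_lift: "leq x y \<Longrightarrow> lift y z \<Longrightarrow> lift x z"
  using lift_leq_trans by blast

lemma acc_trans: "acc x y \<Longrightarrow> acc y z \<Longrightarrow> acc x z"
  by (rule leq_acc) (simp_all add: leq_def)

lemma lift_Def_cases:
  assumes "lift x (Def v t C D)"
  obtains (origin) y where "acc v y" "acc y t" "leq x y"
  | (step) t' C' D' where "t = Def v t' C' D'" "lift x t"
  using assms by cases (auto simp: leq_def)

lemma lift_is_Def: "lift x p \<Longrightarrow> \<exists>v t C D. p = Def v t C D"
  by (cases rule: lift.cases) auto

lemma lift_Def_origin:
  assumes "lift x (Def v t C D)" shows "acc v t" "leq x t"
  using assms by (cases rule: lift_Def_cases; auto simp: leq_def intro: acc_trans leq_acc acc_child)+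

text \<open>Tracing origins back along \<open>lift_Def\<close> ends at a genuine R-successor of
  \<open>v\<close> between \<open>v\<close> and an origin, and that world lifts along the same
  chain.\<close>

lemma lift_via:
  "lift x (Def v t C D) \<Longrightarrow> \<exists>z. acc v z \<and> leq x z \<and> lift z (Def v t C D)"
proof (induction t arbitrary: C D)
  case (Def v' t' t'' C' D')
  from Def.prems show ?case
  proof (cases rule: lift_Def_cases)
    case (origin y)
    then show ?thesis using lift_self by blast
  next
    case (step s E F)
    then show ?thesis using Def.IH(2) lift_Def by blast
  qed
qed (erule lift_Def_cases; blast intro: lift_self)+

lemma leq_Root: "leq x Root \<longleftrightarrow> x = Root"
  using acc.cases[of x Root] lift_is_Def[of x Root] by (auto simp: leq_def)

lemma not_acc_Root: "\<not> acc x Root"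
  using leq_Root[of x] acc_size[of x Root] by (auto simp: leq_def)

text \<open>The critical case is \<open>Def w t C D\<close>, whose proper predecessors lie below
  \<open>w\<close> or lift to it. If one of them lifts, then \<open>acc w t\<close>, so all of them
  lie below \<open>t\<close> and the hypothesis for \<open>t\<close> applies; otherwise the one for
  \<open>w\<close> does.\<close>

lemma leq_linear: "leq x p \<Longrightarrow> leq y p \<Longrightarrow> leq x y \<or> leq y x"
proof (induction p)
  case Root
  then show ?case by (simp add: leq_Root)
next
  case (Crit w A B)
  have "x = Crit w A B \<or> leq x w" if "leq x (Crit w A B)" for x
    using that acc_iff[of w "Crit w A B" x] lift_is_Def by (fastforce simp: leq_def)
  then show ?case using Crit by blast
next
  case (Def w t C D)
  let ?p = "Def w t C D"
  have *: "x = ?p \<or> leq x w \<or> lift x ?p" if "leq x ?p" for x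
    using that acc_iff[of w ?p x] by (auto simp: leq_def)
  have **: "leq x t" if "lift z ?p" "leq x w \<or> lift x ?p" for x z
    using that lift_Def_origin leq_acc leq_def by metis
  show ?case using *[OF Def.prems(1)] *[OF Def.prems(2)] ** Def by blast
qed


section \<open>Criticality\<close>

text \<open>\<open>feeds v t B\<close>: the world \<open>t\<close> is reachable by \<open>S\<^sub>v\<close>-steps from a \<open>B\<close>-critical child of \<open>v\<close>.\<close>

inductive feeds :: "world \<Rightarrow> world \<Rightarrow> fm \<Rightarrow> bool" where
  feeds_Crit: "feeds v (Crit v A B) B"
| feeds_Def: "feeds v t B \<Longrightarrow> feeds v (Def v t C D) B"
| feeds_acc: "acc v x \<Longrightarrow> acc x t \<Longrightarrow> feeds v x B \<Longrightarrow> feeds v t B"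

text \<open>A child is an immediate R-successor of its parent, because a world strictly in between
  would be \<open>leq\<close> the parent.\<close>

lemma no_acc_child: "acc v x \<Longrightarrow> acc x t \<Longrightarrow> \<not> child v t"
  using acc_iff acc_size leq_size by fastforce

text \<open>Trace the derivation of \<open>feeds v z B\<close> backwards. Origins stay above
  \<open>u\<close> until a \<open>feeds_acc\<close> step starts from some \<open>x\<close>,
  comparable with \<open>u\<close> by \<open>leq_linear\<close>, with \<open>leq x u\<close>; then
  \<open>x\<close> also precedes the child \<open>y\<close> of \<open>u\<close>.\<close>

lemma feeds_sibling:
  assumes "feeds v z B" "acc v u \<or> lift v u" "child u y" "acc u z \<or> lift u z"
  shows "feeds v y B"
  using assms
proof (induction rule: feeds.induct)
  case (feeds_Crit v A B)
  then have "leq u v" using acc_iff[of v "Crit v A B" u] lift_is_Def by fastforce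
  then show ?case using feeds_Crit leq_size acc_size lift_size by fastforce
next
  case (feeds_Def v t B C D)
  have "\<not> leq u v" using feeds_Def leq_size acc_size lift_size by fastforce
  then have "lift u (Def v t C D)" using feeds_Def.prems acc_iff[of v "Def v t C D" u] by auto
  then have "acc u t \<or> lift u t" by (cases rule: lift_Def_cases) (auto intro: leq_acc)
  then show ?case using feeds_Def by blast
next
  case (feeds_acc v x t B)
  have "leq u x \<or> leq x u" using leq_linear feeds_acc unfolding leq_def by blast
  then consider "leq x u" | "acc u x \<or> lift u x" by (auto simp: leq_def)
  then show ?case
  proof cases
    case 1
    then have "acc x y" using feeds_acc.prems acc_iff by blast
    then show ?thesis using feeds_acc feeds.feeds_acc by blast
  qed (use feeds_acc in blast)
qed

text \<open>Only lifts into \<open>Def u t C D\<close> are delicate. For \<open>u = v\<close> the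
  property passes through the origin \<open>t\<close>; otherwise \<open>lift_via\<close> gives a
  smaller world above \<open>u\<close> that has it, and \<open>feeds_sibling\<close> transfers it to
  the child of \<open>u\<close>.\<close>

lemma feeds_mono:
  "leq y z \<Longrightarrow> acc v y \<Longrightarrow> acc v z \<Longrightarrow> feeds v y B \<Longrightarrow> feeds v z B"
proof (induction "size z" arbitrary: y z rule: less_induct)
  case less
  from less.prems(1) consider "y = z" | "acc y z" | "lift y z" by (auto simp: leq_def)
  then show ?case
  proof cases
    case 2
    then show ?thesis using less.prems feeds_acc by blast
  next
    case 3
    then obtain u t C D where z: "z = Def u t C D" using lift_is_Def by blast
    show ?thesis
    proof (cases "v = u")
      case True
      have "feeds v t B"
        using 3 unfolding z
      proof (cases rule: lift_Def_cases)
        case (origin x)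
        then show ?thesis using less.prems feeds_acc leq_acc by blast
      next
        case (step t' C' D')
        then show ?thesis
          using less.hyps[of t y] less.prems True by (simp add: z leq_def acc_child)
      qed
      then show ?thesis using True z feeds_Def by blast
    next
      case False
      have "leq v u" using less.prems(3) acc_iff[of u z v] z by simp
      then have vu: "acc v u \<or> lift v u" using False by (simp add: leq_def)
      obtain x where x: "acc u x" "leq y x" "lift x z" using lift_via 3 z by blast
      have "feeds v x B"
        using less.hyps[OF lift_size[OF x(3)] x(2)] less.prems leq_acc[OF \<open>leq v u\<close> x(1)] by blast
      then show ?thesis using feeds_sibling[of v x B u z] vu x z by simp
    qed
  qed (use less in blast)
qed

text \<open>For a child \<open>t\<close> of \<open>v\<close> the first alternative is void by
  \<open>no_acc_child\<close>; the lifting worlds take its place, since their boxed formulas must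
  survive at all worlds above \<open>t\<close>.\<close>

definition between :: "world \<Rightarrow> world \<Rightarrow> world set" where
  "between v t = {x. acc v x \<and> (acc x t \<or> child v t \<and> lift x t)}"

lemma between_Crit: "between v (Crit v A B) = {}"
  using no_acc_child lift_is_Def by (fastforce simp: between_def)

text \<open>With \<open>feeds_DefD\<close>: the label of the new child is contained in that of its
  origin, so a set chosen for the origin's label also fits the child.\<close>

lemma between_Def: "between v (Def v t C D) \<subseteq> between v t"
proof
  fix x assume "x \<in> between v (Def v t C D)"
  then have x: "acc v x" "lift x (Def v t C D)"
    using no_acc_child by (fastforce simp: between_def)+
  from x(2) show "x \<in> between v t"
    by (cases rule: lift_Def_cases) (use x(1) in \<open>auto simp: between_def intro: leq_acc\<close>)
qed

lemma feeds_CritD: "feeds v (Crit v A B) B' \<Longrightarrow> B' = B"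
  by (cases rule: feeds.cases) (use no_acc_child in fastforce)+

lemma feeds_DefD: "feeds v (Def v t C D) B \<Longrightarrow> feeds v t B"
  by (cases rule: feeds.cases) (use no_acc_child in fastforce)+


section \<open>The model\<close>

definition witness :: "fm set \<Rightarrow> fm set \<Rightarrow> fm \<Rightarrow> fm set" where
  "witness \<Gamma> T A = (SOME \<Delta>. mcs \<Delta> \<and> assuring \<Gamma> T \<Delta> \<and> A \<in> \<Delta> \<and> \<^bold>\<box> \<^bold>\<not> A \<in> \<Delta>)"

lemma witness:
  assumes "mcs \<Gamma>" "A \<notin> assured \<Gamma> T"
  shows "mcs (witness \<Gamma> T A)" "assuring \<Gamma> T (witness \<Gamma> T A)"
    "A \<in> witness \<Gamma> T A" "\<^bold>\<box> \<^bold>\<not> A \<in> witness \<Gamma> T A"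
  using someI_ex[OF assuring_exists[OF assms]] unfolding witness_def by auto

primrec subs :: "fm \<Rightarrow> fm set" where
  "subs (Var p) = {Var p}"
| "subs \<^bold>\<bottom> = {\<^bold>\<bottom>}"
| "subs (A \<^bold>\<longrightarrow> B) = {A \<^bold>\<longrightarrow> B} \<union> subs A \<union> subs B"
| "subs (\<^bold>\<box> A) = {\<^bold>\<box> A} \<union> subs A"
| "subs (A \<rhd> B) = {A \<rhd> B} \<union> subs A \<union> subs B"

lemma subs_refl: "A \<in> subs A" and finite_subs: "finite (subs A)"
  by (induction A) auto

locale construction =
  fixes \<Gamma>\<^sub>0 :: "fm set" and \<Phi> :: "fm set"
  assumes root: "mcs \<Gamma>\<^sub>0" and finite_\<Phi>: "finite \<Phi>"
begin

text \<open>The bound on \<open>size x\<close> holds for all members of \<open>between w t\<close>; it is there for the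
  termination proof.\<close>

function mset :: "world \<Rightarrow> fm set" where
  "mset Root = \<Gamma>\<^sub>0"
| "mset (Crit w A B) = witness (mset w) {\<^bold>\<not> B} A"
| "mset (Def w t C D) = witness (mset w)
     ({\<^bold>\<not> B | B. feeds w t B} \<union> (\<Union>x\<in>{x \<in> between w t. size x < size t}. boxes (mset x))) D"
  by pat_completeness auto
termination by (relation "measure size") auto

definition label :: "world \<Rightarrow> world \<Rightarrow> fm set" where
  "label v t = {\<^bold>\<not> B | B. feeds v t B} \<union> (\<Union>x\<in>between v t. boxes (mset x))"

lemma mset_Def: "mset (Def w t C D) = witness (mset w) (label w t) D"
proof -
  have "{x \<in> between w t. size x < size t} = between w t"
    using acc_size lift_size by (auto simp: between_def)
  then show ?thesis by (simp add: label_def)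
qed

declare mset.simps(3) [simp del]

text \<open>Only terms answering an actual demand become worlds. The formula a new world is built to
  contain, \<open>A\<close> or \<open>D\<close>, comes from the finite \<Phi>, which bounds R-chains
  in \<open>wf_Rel\<close>.\<close>

inductive ok :: "world \<Rightarrow> bool" where
  ok_Root: "ok Root"
| ok_Crit: "ok w \<Longrightarrow> A \<in> \<Phi> \<Longrightarrow> (A \<rhd> B) \<notin> mset w \<Longrightarrow> ok (Crit w A B)"
| ok_Def: "ok w \<Longrightarrow> ok t \<Longrightarrow> acc w t \<Longrightarrow> (C \<rhd> D) \<in> mset w \<Longrightarrow> C \<in> mset t \<Longrightarrow> D \<in> \<Phi> \<Longrightarrow>
    ok (Def w t C D)"

lemma ok_parent: "ok x \<Longrightarrow> child p x \<Longrightarrow> ok p"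
  by (cases rule: ok.cases) auto

lemma ok_origin: "ok (Def v t C D) \<Longrightarrow> ok t"
  by (cases rule: ok.cases) auto

lemma acc_ok: "acc x y \<Longrightarrow> ok y \<longrightarrow> ok x"
  and lift_ok: "lift x y \<Longrightarrow> ok y \<longrightarrow> ok x"
  by (induction rule: acc_lift.inducts) (auto dest: ok_parent ok_origin)

lemma leq_ok: "leq x y \<Longrightarrow> ok y \<Longrightarrow> ok x"
  using acc_ok lift_ok by (auto simp: leq_def)

definition sound :: "world \<Rightarrow> bool" where
  "sound t \<longleftrightarrow> mcs (mset t) \<and> (\<forall>v. acc v t \<longrightarrow> assuring (mset v) (label v t) (mset t)) \<and>
     (\<forall>x. leq x t \<longrightarrow> boxes (mset x) \<subseteq> mset t)"

lemma leq_boxes: "sound t \<Longrightarrow> leq x t \<Longrightarrow> \<^bold>\<box> A \<in> mset x \<Longrightarrow> \<^bold>\<box> A \<in> mset t"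
  unfolding sound_def boxes_def by blast

text \<open>The set of \<open>t\<close> is chosen with regard to the parent \<open>p\<close> alone;
  the rest is inherited. Boxed formulas come through \<open>p\<close>, or for lifts through a world
  of \<open>between p t\<close> found by \<open>lift_via\<close>. For another predecessor
  \<open>v\<close> it suffices to find Box Neg A at \<open>p\<close>.\<close>

lemma sound_child:
  assumes c: "child p t" and ok: "ok t"
    and IH: "\<And>x. size x < size t \<Longrightarrow> ok x \<Longrightarrow> sound x"
    and t: "mcs (mset t)" and pt: "assuring (mset p) (label p t) (mset t)"
  shows "sound t"
proof -
  have p: "sound p" using IH child_size[OF c] ok_parent[OF ok c] by blast
  then have mp: "mcs (mset p)" by (simp add: sound_def)
  have box: "\<^bold>\<box> A \<in> mset t" if "leq x t" "\<^bold>\<box> A \<in> mset x" for x A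
  proof -
    from that(1) consider "x = t" | "acc x t" | "lift x t" by (auto simp: leq_def)
    then show ?thesis
    proof cases
      case 2
      then show ?thesis using leq_boxes[OF p] that acc_iff[OF c] assuring_Box(2)[OF mp t pt] by blast
    next
      case 3
      then obtain u s C D where d: "t = Def u s C D" using lift_is_Def by blast
      with c have "u = p" by simp
      then obtain z where z: "acc p z" "leq x z" "lift z t" using lift_via 3 d by blast
      then have "\<^bold>\<box> A \<in> mset z" using leq_boxes[of z x A] IH lift_size lift_ok ok that by blast
      then have "\<^bold>\<box> A \<in> label p t" using z c by (auto simp: label_def between_def boxes_iff)
      then show ?thesis using assuring_label[OF mp t pt] by blast
    qed (use that in simp)
  qed
  have "assuring (mset v) (label v t) (mset t)" if v: "acc v t" "v \<noteq> p" for v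
  proof -
    have vp: "leq v p" using v acc_iff[OF c] by blast
    have mv: "mcs (mset v)" using IH acc_size acc_ok v ok unfolding sound_def by blast
    have nc: "\<not> child v t" using c v(2) by (auto simp: child_def)
    txt \<open>The parent \<open>p\<close> need not be a successor of \<open>v\<close>, so the label of \<open>t\<close> is passed on from the
      last successor of \<open>v\<close> below \<open>p\<close>.\<close>
    let ?X = "{x. acc v x \<and> leq x p}"
    have lab: "\<exists>x\<in>?X. \<sigma> \<in> label v x \<union> boxes (mset x)" if \<sigma>: "\<sigma> \<in> label v t" for \<sigma>
    proof -
      consider B where "\<sigma> = \<^bold>\<not> B" "feeds v t B"
        | x where "acc v x" "acc x t" "\<sigma> \<in> boxes (mset x)"
        using \<sigma> nc by (auto simp: label_def between_def)
      then show ?thesis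
      proof cases
        case 1
        from 1(2) obtain x where "acc v x" "acc x t" "feeds v x B"
          by cases (use nc in auto)
        then show ?thesis using 1(1) acc_iff[OF c] by (auto simp: label_def)
      qed (use acc_iff[OF c] in blast)
    qed
    have "\<^bold>\<box> \<^bold>\<not> A \<in> mset p" if A: "A \<in> assured (mset v) (label v t)" for A
    proof (cases "?X = {}")
      case True
      \<comment> \<open>The disjunction over an empty label is Bot, so an assured A satisfies A Rhd
        Bot.\<close>
      then have "label v t = {}" using lab by blast
      then have "(A \<rhd> \<^bold>\<bottom>) \<in> mset v" using A by (simp add: assured_def disj_def)
      then show ?thesis using leq_boxes[OF p vp] mcs_Rhd_Bot[OF mv] by blast
    next
      case False
      obtain x where x: "acc v x" "leq x p" and max: "\<And>y. y \<in> ?X \<Longrightarrow> size y \<le> size x"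
      proof -
        obtain y where "y \<in> ?X" using False by blast
        moreover have "\<forall>y. y \<in> ?X \<longrightarrow> size y < Suc (size p)"
          using leq_size by (simp add: less_Suc_eq_le)
        ultimately have "\<exists>x. x \<in> ?X \<and> (\<forall>y. y \<in> ?X \<longrightarrow> size y \<le> size x)"
          by (rule ex_has_greatest_nat)
        then show thesis using that by blast
      qed
      have "size x < size t" "ok x"
        using leq_size[OF x(2)] child_size[OF c] leq_ok[OF x(2) ok_parent[OF ok c]] by linarith+
      then have sx: "sound x" by (rule IH)
      \<comment> \<open>\<open>acc\<close> and \<open>lift\<close> strictly increase size, so
        linearity turns the member of maximal size into the greatest one.\<close>
      have yx: "leq y x" if "y \<in> ?X" for y
      proof -
        have "\<not> acc x y" "\<not> lift x y" using max[OF that] acc_size lift_size leD by blast+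
        moreover have "leq x y \<or> leq y x" using leq_linear x(2) that by blast
        ultimately show ?thesis by (auto simp: leq_def)
      qed
      have "label v t \<subseteq> label v x \<union> boxes (mset x)"
      proof
        fix \<sigma> assume "\<sigma> \<in> label v t"
        then obtain y where y: "y \<in> ?X" "\<sigma> \<in> label v y \<union> boxes (mset y)" using lab by blast
        have bx: "\<sigma> \<in> boxes (mset x)" if "leq z x" "\<sigma> \<in> boxes (mset z)" for z
          using that leq_boxes[OF sx] by (auto simp: boxes_def)
        consider B where "\<sigma> = \<^bold>\<not> B" "feeds v y B"
          | z where "leq z y" "z \<in> ?X" "\<sigma> \<in> boxes (mset z)" | "\<sigma> \<in> boxes (mset y)"
        proof -
          have "z \<in> ?X" "leq z y" if "z \<in> between v y" for z
            using that y(1) leq_acc leq_lift unfolding between_def leq_def by blast+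
          then show thesis using y(2) that unfolding label_def by blast
        qed
        then show "\<sigma> \<in> label v x \<union> boxes (mset x)"
        proof cases
          case 1
          then have "feeds v x B" using feeds_mono yx[OF y(1)] y(1) x(1) by blast
          then show ?thesis using 1 by (auto simp: label_def)
        qed (use bx yx y in blast)+
      qed
      \<comment> \<open>The label of \<open>x\<close> has grown by the boxes of \<open>x\<close>
        itself, which is the situation of \<open>assured_boxes\<close>.\<close>
      then have "A \<in> assured (mset v) (label v x \<union> boxes (mset x))"
        using A assured_mono by blast
      then have "\<^bold>\<box> \<^bold>\<not> A \<in> mset x"
        using assured_boxes[OF mv] sx x(1) unfolding sound_def by blast
      then show ?thesis using leq_boxes[OF p x(2)] by blast
    qed
    then show ?thesis using assuring_Box[OF mp t pt] unfolding assuring_def by blast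
  qed
  then show ?thesis using t pt box unfolding sound_def boxes_def by blast
qed

text \<open>Induction on size rather than along parents, since a \<open>Def\<close> world also
  depends on its origin \<open>s\<close>. There D cannot be assured: C would be assured too,
  although C holds at \<open>s\<close>.\<close>

lemma ok_sound_demand:
  "ok t \<Longrightarrow> sound t \<and> (t = Root \<or> (\<exists>A\<in>\<Phi>. A \<in> mset t \<and> \<^bold>\<box> \<^bold>\<not> A \<in> mset t))"
proof (induction "size t" arbitrary: t rule: less_induct)
  case less
  have IH: "sound x" if "size x < size t" "ok x" for x using less.hyps that by blast
  from less.prems show ?case
  proof cases
    case ok_Root
    then show ?thesis using root by (auto simp: sound_def boxes_def leq_Root not_acc_Root)
  next
    case (ok_Crit w A B)
    then have w: "mcs (mset w)" using IH by (simp add: sound_def)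
    then have "A \<notin> assured (mset w) {\<^bold>\<not> B}"
      using critical_not_assured ok_Crit by blast
    note wit = witness[OF w this]
    have "label w t \<subseteq> {\<^bold>\<not> B}"
      using feeds_CritD by (auto simp: ok_Crit label_def between_Crit)
    then have "sound t"
      using sound_child[OF _ less.prems IH, of w] wit assuring_mono by (auto simp: ok_Crit)
    then show ?thesis using wit ok_Crit by auto
  next
    case (ok_Def w s C D)
    then have "sound w" "sound s" using IH by simp_all
    then have w: "mcs (mset w)" and s: "mcs (mset s)" "assuring (mset w) (label w s) (mset s)"
      using ok_Def by (auto simp: sound_def)
    have "D \<notin> assured (mset w) (label w s)"
    proof
      assume "D \<in> assured (mset w) (label w s)"
      then have "\<^bold>\<not> C \<in> mset s"
        using s(2) ok_Def assured_Rhd[OF w] unfolding assuring_def by blast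
      then show False using ok_Def s(1) by (simp add: mcs_simps)
    qed
    note wit = witness[OF w this]
    have "label w t \<subseteq> label w s"
      unfolding label_def ok_Def using between_Def feeds_DefD by fastforce
    then have "sound t"
      using sound_child[OF _ less.prems IH, of w] wit assuring_mono
      by (auto simp: ok_Def mset_Def)
    then show ?thesis using wit ok_Def by (auto simp: mset_Def)
  qed
qed

lemma ok_mcs: "ok t \<Longrightarrow> mcs (mset t)"
  and ok_leq_boxes: "ok t \<Longrightarrow> leq x t \<Longrightarrow> \<^bold>\<box> A \<in> mset x \<Longrightarrow> \<^bold>\<box> A \<in> mset t"
  and ok_assuring: "ok t \<Longrightarrow> acc v t \<Longrightarrow> assuring (mset v) (label v t) (mset t)"
  using ok_sound_demand leq_boxes unfolding sound_def by blast+

lemma acc_Box: "ok t \<Longrightarrow> acc v t \<Longrightarrow> \<^bold>\<box> A \<in> mset v \<Longrightarrow> A \<in> mset t"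
  using assuring_Box(1) ok_assuring ok_mcs acc_ok by blast

section \<open>The frame and its conditions\<close>

definition Rel :: "world rel" where
  "Rel = {(x, y). ok x \<and> ok y \<and> acc x y}"

definition Sstep :: "world \<Rightarrow> world \<Rightarrow> world \<Rightarrow> bool" where
  "Sstep w y z \<longleftrightarrow> acc y z \<or> (\<exists>C D. z = Def w y C D)"

definition Srel :: "world \<Rightarrow> world rel" where
  "Srel w = {(y, z). ok y \<and> ok z \<and> acc w y \<and> (Sstep w)\<^sup>*\<^sup>* y z}"

lemma Sstep_acc: "(Sstep w)\<^sup>*\<^sup>* y z \<Longrightarrow> acc w y \<Longrightarrow> acc w z"
  by (induction rule: rtranclp_induct) (auto simp: Sstep_def intro: acc_trans acc_child)

lemma Sstep_feeds: "(Sstep w)\<^sup>*\<^sup>* y z \<Longrightarrow> acc w y \<Longrightarrow> feeds w y B \<Longrightarrow> feeds w z B"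
proof (induction rule: rtranclp_induct)
  case (step t t')
  then have "acc w t" "feeds w t B" using Sstep_acc by blast+
  then show ?case using step.hyps(2) unfolding Sstep_def by (auto intro: feeds_acc feeds_Def)
qed

text \<open>The number of A in \<Phi> with Box Neg A in the set grows strictly along R: the A that
  \<open>y\<close> was built for is new, as Box Neg A at \<open>x\<close> would refute it at
  \<open>y\<close>.\<close>

lemma wf_Rel: "wf (Rel\<inverse>)"
proof -
  define F where "F t = {A \<in> \<Phi>. \<^bold>\<box> \<^bold>\<not> A \<in> mset t}" for t
  have fin: "finite (F t)" for t using finite_\<Phi> by (simp add: F_def)
  have "card (F x) < card (F y)" if "(x, y) \<in> Rel" for x y
  proof -
    have xy: "ok x" "ok y" "acc x y" using that by (auto simp: Rel_def)
    have "y \<noteq> Root" using xy(3) not_acc_Root by blast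
    then obtain A where A: "A \<in> \<Phi>" "A \<in> mset y" "\<^bold>\<box> \<^bold>\<not> A \<in> mset y"
      using ok_sound_demand xy by blast
    have "\<^bold>\<box> \<^bold>\<not> A \<notin> mset x"
      using acc_Box[OF xy(2,3), of "\<^bold>\<not> A"] A ok_mcs[OF xy(2)] by (auto simp: mcs_simps)
    moreover have "F x \<subseteq> F y"
      using ok_leq_boxes[OF xy(2)] xy(3) unfolding F_def leq_def by blast
    ultimately show ?thesis
      using A by (intro psubset_card_mono[OF fin]) (auto simp: F_def)
  qed
  moreover have "card (F x) \<le> card \<Phi>" for x
    by (rule card_mono[OF finite_\<Phi>]) (auto simp: F_def)
  ultimately have "Rel\<inverse> \<subseteq> measure (\<lambda>x. card \<Phi> - card (F x))"
    by (fastforce intro!: diff_less_mono2 dest: order.strict_trans2)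
  then show ?thesis using wf_subset by blast
qed

lemma frame: "IL_frame {x. ok x} Rel Srel"
proof
  show "{x. ok x} \<noteq> {}" using ok_Root by blast
  show "countable {x. ok x}" by simp
  show "Rel \<subseteq> {x. ok x} \<times> {x. ok x}" by (auto simp: Rel_def)
  show "wf (Rel\<inverse>)" by (rule wf_Rel)
  show "trans Rel" unfolding trans_def Rel_def using acc_trans by blast
  show "(x, y) \<in> Rel \<and> (x, z) \<in> Rel" if "x \<in> {x. ok x}" "(y, z) \<in> Srel x" for x y z
    using that Sstep_acc by (auto simp: Rel_def Srel_def)
  show "(y, y) \<in> Srel x" if "(x, y) \<in> Rel" for x y
    using that by (auto simp: Rel_def Srel_def)
  show "(y, z) \<in> Srel x" if "(x, y) \<in> Rel" "(y, z) \<in> Rel" for x y z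
    using that by (auto simp: Rel_def Srel_def Sstep_def)
  show "trans (Srel x)" for x
    unfolding trans_def Srel_def using rtranclp_trans by fastforce
qed

lemma frame_condition: "M0_frame_condition Rel Srel"
proof -
  have "acc x z" if "acc w x" "acc x y" "(Sstep w)\<^sup>*\<^sup>* y y'" "acc y' z" for w x y y' z
  proof -
    \<comment> \<open>Invariant along the chain: a \<open>Def\<close> step turns \<open>acc\<close>
      into \<open>lift\<close> by \<open>lift_self\<close> and keeps \<open>lift\<close> by
      \<open>lift_Def\<close>; an \<open>acc\<close> step restores \<open>acc\<close>.\<close>
    from that(3) have "acc x y' \<or> lift x y' \<and> child w y'"
    proof (induction rule: rtranclp_induct)
      case (step t t')
      then consider "acc t t'" | C D where "t' = Def w t C D" by (auto simp: Sstep_def)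
      then show ?case
      proof cases
        case 1
        then show ?thesis using step.IH leq_acc unfolding leq_def by blast
      next
        case 2
        then show ?thesis using step.IH that(1) lift_self lift_is_Def lift_Def child_simps(3)
          by metis
      qed
    qed (use that in simp)
    then show ?thesis using that(4) leq_acc unfolding leq_def by blast
  qed
  then show ?thesis unfolding M0_frame_condition_def Rel_def Srel_def by blast
qed

section \<open>The truth lemma\<close>

definition Val :: "nat \<Rightarrow> world set" where
  "Val p = {t. Var p \<in> mset t}"

lemma critical_child:
  assumes "ok t" "A \<in> \<Phi>" "(A \<rhd> B) \<notin> mset t"
  obtains u where "(t, u) \<in> Rel" "A \<in> mset u" "\<And>v. (u, v) \<in> Srel t \<Longrightarrow> B \<notin> mset v"
proof
  let ?u = "Crit t A B"
  have u: "ok ?u" using assms by (rule ok_Crit)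
  have tu: "acc t ?u" by (simp add: acc_child)
  show "(t, ?u) \<in> Rel" using u tu assms(1) by (simp add: Rel_def)
  show "A \<in> mset ?u"
    using witness(3) critical_not_assured ok_mcs assms by simp
  fix v assume "(?u, v) \<in> Srel t"
  then have v: "ok v" "(Sstep t)\<^sup>*\<^sup>* ?u v" by (auto simp: Srel_def)
  then have "\<^bold>\<not> B \<in> label t v"
    using Sstep_feeds[OF v(2) tu feeds_Crit] by (auto simp: label_def)
  then have "\<^bold>\<not> B \<in> mset v"
    using assuring_label ok_mcs ok_assuring assms(1) v(1) Sstep_acc[OF v(2) tu] by blast
  then show "B \<notin> mset v" using ok_mcs[OF v(1)] by (auto simp: mcs_simps)
qed

lemma Rhd_successor:
  assumes "ok t" "(A \<rhd> B) \<in> mset t" "(t, u) \<in> Rel" "A \<in> mset u" "B \<in> \<Phi>"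
  obtains v where "(u, v) \<in> Srel t" "B \<in> mset v"
proof
  let ?v = "Def t u A B"
  have tu: "ok u" "acc t u" using assms(3) by (auto simp: Rel_def)
  then have "ok ?v" using ok_Def assms by blast
  then show "(u, ?v) \<in> Srel t" using tu by (auto simp: Srel_def Sstep_def)
  have "B \<notin> assured (mset t) (label t u)"
  proof
    assume "B \<in> assured (mset t) (label t u)"
    then have "\<^bold>\<not> A \<in> mset u"
      using ok_assuring[OF tu] assured_Rhd[OF ok_mcs[OF assms(1)] assms(2)]
      unfolding assuring_def by blast
    then show False using assms(4) ok_mcs[OF tu(1)] by (simp add: mcs_simps)
  qed
  then show "B \<in> mset ?v" using witness(3) ok_mcs assms(1) by (simp add: mset_Def)
qed

lemma truth:
  "\<forall>B\<in>subs A. B \<in> \<Phi> \<and> \<^bold>\<not> B \<in> \<Phi> \<Longrightarrow> ok t \<Longrightarrow> forces Rel Srel Val t A \<longleftrightarrow> A \<in> mset t"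
proof (induction A arbitrary: t)
  case (Box A)
  have IH: "forces Rel Srel Val u A \<longleftrightarrow> A \<in> mset u" if "ok u" for u
    using Box that by auto
  show ?case
  proof (cases "\<^bold>\<box> A \<in> mset t")
    case True
    then show ?thesis using acc_Box IH by (auto simp: Rel_def)
  next
    case False
    \<comment> \<open>A refuted Box A is handled as a refuted (Neg A) Rhd Bot; this is why \<Phi>
      has to contain negations of subformulas.\<close>
    have "(\<^bold>\<not> A \<rhd> \<^bold>\<bottom>) \<notin> mset t"
    proof
      assume "(\<^bold>\<not> A \<rhd> \<^bold>\<bottom>) \<in> mset t"
      then have *: "\<^bold>\<box> \<^bold>\<not> \<^bold>\<not> A \<in> mset t" using mcs_Rhd_Bot ok_mcs Box.prems by blast
      have "\<^bold>\<box> A \<in> mset t"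
        by (rule mcs_Box_mono[OF ok_mcs[OF Box.prems(2)] ILM0_taut *]) simp
      then show False using False by blast
    qed
    moreover have "\<^bold>\<not> A \<in> \<Phi>" using Box.prems(1) subs_refl by auto
    ultimately obtain u where u: "(t, u) \<in> Rel" "\<^bold>\<not> A \<in> mset u"
      using critical_child[OF Box.prems(2)] by metis
    then have "A \<notin> mset u" using ok_mcs by (auto simp: Rel_def mcs_simps)
    then show ?thesis using False u IH by (auto simp: Rel_def)
  qed
next
  case (Rhd A B)
  have IH: "forces Rel Srel Val u A \<longleftrightarrow> A \<in> mset u" "forces Rel Srel Val u B \<longleftrightarrow> B \<in> mset u"
    if "ok u" for u
    using Rhd that by auto
  have \<Phi>: "A \<in> \<Phi>" "B \<in> \<Phi>" using Rhd.prems(1) subs_refl by auto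
  have okR: "ok u" if "(t, u) \<in> Rel" for u using that by (simp add: Rel_def)
  have okS: "ok v" if "(u, v) \<in> Srel t" for u v using that by (simp add: Srel_def)
  show ?case
  proof (cases "A \<rhd> B \<in> mset t")
    case True
    then show ?thesis
      unfolding forces.simps using Rhd_successor[OF Rhd.prems(2) True _ _ \<Phi>(2)] IH okR okS by metis
  next
    case False
    then show ?thesis
      unfolding forces.simps using critical_child[OF Rhd.prems(2) \<Phi>(1) False] IH okR okS by metis
  qed
qed (auto simp: Val_def mcs_simps ok_mcs)

end

theorem theorem6p1:
  fixes \<phi> :: fm
  assumes "M0_valid TYPE(nat) \<phi>"
  shows "\<phi> \<in> ILM0"
proof (rule ccontr)
  assume "\<phi> \<notin> ILM0"
  then obtain \<Gamma> where \<Gamma>: "mcs \<Gamma>" "\<phi> \<notin> \<Gamma>" using ILM0_iff_mcs by blast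
  interpret construction \<Gamma> "subs \<phi> \<union> (\<lambda>A. \<^bold>\<not> A) ` subs \<phi>"
    by standard (simp_all add: \<Gamma>(1) finite_subs)
  have "M0_valid TYPE(world) \<phi>" using assms by (rule M0_valid_nat_imp_M0_valid)
  then have "forces Rel Srel Val Root \<phi>"
    unfolding M0_valid_def using frame frame_condition ok_Root by blast
  then show False using truth[OF _ ok_Root, of \<phi>] \<Gamma>(2) by simp
qed

end
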